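(* Let $X$ be an arbitrary set of variables, $\mathcal{R}=\mathbb{C}[[X]]$, let $\boldsymbol{\phi}=\{\phi_x(X)\}_{x\in S}$, $S\subseteq X$, be a summable family in $\mathcal{R}$, let $\mathscr{D}^{\boldsymbol\phi}=\sum_{x\in S}\phi_x(X)\partial_x$, and for $x\in X$ let $F_x(t)=e^{t\mathscr{D}^{\boldsymbol\phi}}x=\sum_{n\ge0}(\mathscr{D}^{\boldsymbol\phi})^nx\,\frac{t^n}{n!}\in\mathcal{R}[[t]]$. Let $H(X)\in\mathcal{R}$ be a nonzero formal power series. Then for every $n\ge1$ $$\mathcal{A}_{H(F_x(t))_{x\in X}}[n]=(\mathscr{D}^{\boldsymbol\phi})^{n-1}H^n(X).$$ In particular, $\mathcal{A}_{F_x(t)}[n]=(\mathscr{D}^{\boldsymbol\phi})^{n-1}x^n$ for every $x\in X$.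
   Context: $\mathbb{C}[[X]]$ ($X$ finite or infinite) consists of the formal sums $H(X)=\sum_{\mathbf{k}\in\mathbb{N}_X}H[\mathbf{k}]\frac{X^{\mathbf{k}}}{\mathbf{k}!}$, where $\mathbb{N}_X$ is the set of finitely supported tuples $\mathbf{k}=(k_x)_{x\in X}$ of non-negative integers, $X^{\mathbf{k}}=\prod x^{k_x}$, $\mathbf{k}!=\prod k_x!$. A family $\{G_s\}_{s\in S}$ in $\mathbb{C}[[X]]$ is summable if for each $\mathbf{k}$ one has $G_s[\mathbf{k}]=0$ for all but finitely many $s$. $\partial_x$ is the partial derivative with respect to $x$. $H(F_x(t))_{x\in X}=\sum_{\mathbf{k}}H[\mathbf{k}]\frac{\prod_xF_x(t)^{k_x}}{\mathbf{k}!}$ is the substitution of $F_x(t)$ for each variable $x$ (well defined in $\mathbb{C}[[X,t]]=\mathcal{R}[[t]]$). For $G(t)=\sum_{m\ge0}G[m]\frac{t^m}{m!}\in\mathcal{R}[[t]]$ with nonzero constant term, $\mathcal{A}_G(t)=\sum_{n\ge1}\mathcal{A}_G[n]\frac{t^n}{n!}\in\mathcal{R}[[t]]$ is the generating series of $G$-enriched rooted trees, defined by $\mathcal{A}_G(t)=t\,G(\mathcal{A}_G(t))$; equivalently $\mathcal{A}_G[n]=\sum_T\prod_{v=1}^nG[|T^{-1}(v)|]$, the sum over all labelled rooted trees $T$ on $\{1,\dots,n\}$, $T^{-1}(v)$ being the set of children of $v$. *)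

theory Defs
  imports
    "HOL-Library.Poly_Mapping"
    "HOL-Computational_Algebra.Formal_Power_Series"
begin

unbundle fps_syntax

section \<open>Formal power series in arbitrarily many variables\<close>

text \<open>
  Exponents are finitely supported tuples, but the number of monomials occurring in a series is
  unrestricted. \<open>mps_coeff H k\<close> is the ordinary coefficient of the monomial \<open>X\<^sup>k\<close>, that is,
  \<open>H[k] / k!\<close> in the notation \<open>H(X) = (\<Sum>k. H[k] X\<^sup>k / k!)\<close>.
\<close>

typedef 'x mps = "UNIV :: (('x \<Rightarrow>\<^sub>0 nat) \<Rightarrow> complex) set"
  morphisms mps_coeff Abs_mps
  by simp

lemma mps_coeff_Abs [simp]: "mps_coeff (Abs_mps f) = f"
  by (simp add: Abs_mps_inverse)

lemma mps_eqI: "(\<And>k. mps_coeff G k = mps_coeff H k) \<Longrightarrow> G = H"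
  by (metis ext mps_coeff_inject)

abbreviation splits :: "('x \<Rightarrow>\<^sub>0 nat) \<Rightarrow> (('x \<Rightarrow>\<^sub>0 nat) \<times> ('x \<Rightarrow>\<^sub>0 nat)) set" where
  "splits k \<equiv> {(i, j). i + j = k}"

lemma finite_splits [simp]: "finite (splits k)"
proof -
  let ?I = "{i. \<exists>j. i + j = k}"
  let ?r = "\<lambda>i. restrict (Poly_Mapping.lookup i) (Poly_Mapping.keys k)"
  have le: "Poly_Mapping.lookup i x \<le> Poly_Mapping.lookup k x" if "i \<in> ?I" for i x
    using that by (auto simp: lookup_add)
  have "inj_on ?r ?I"
  proof (rule inj_onI, rule poly_mapping_eqI)
    fix i i' x
    assume i: "i \<in> ?I" "i' \<in> ?I" and eq: "?r i = ?r i'"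
    show "Poly_Mapping.lookup i x = Poly_Mapping.lookup i' x"
    proof (cases "x \<in> Poly_Mapping.keys k")
      case True
      then show ?thesis using fun_cong[OF eq, of x] by simp
    next
      case False
      then show ?thesis using le[OF i(1), of x] le[OF i(2), of x] by (simp add: in_keys_iff)
    qed
  qed
  moreover have "?r ` ?I \<subseteq> PiE (Poly_Mapping.keys k) (\<lambda>x. {..Poly_Mapping.lookup k x})"
    using le by auto
  then have "finite (?r ` ?I)"
    by (rule finite_subset) (auto intro!: finite_PiE)
  ultimately have fin: "finite ?I"
    by (rule finite_imageD[rotated])
  have "splits k \<subseteq> ?I \<times> ?I"
    using add.commute by blast
  then show ?thesis
    by (rule finite_subset) (simp add: fin)
qed

instantiation mps :: (type) comm_ring_1
begin

definition "0 = Abs_mps (\<lambda>k. 0)"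
definition "1 = Abs_mps (\<lambda>k. if k = 0 then 1 else 0)"
definition "G + H = Abs_mps (\<lambda>k. mps_coeff G k + mps_coeff H k)"
definition "G - H = Abs_mps (\<lambda>k. mps_coeff G k - mps_coeff H k)"
definition "- H = Abs_mps (\<lambda>k. - mps_coeff H k)"
definition "G * H = Abs_mps (\<lambda>k. \<Sum>(i, j)\<in>splits k. mps_coeff G i * mps_coeff H j)"

instance
proof
  fix a b c :: "'a mps"
  show "a + b + c = a + (b + c)" "a + b = b + a" "0 + a = a" "- a + a = 0" "a - b = a + - b"
    by (simp_all add: plus_mps_def zero_mps_def uminus_mps_def minus_mps_def mps_coeff_inverse
        algebra_simps)
  show "(0::'a mps) \<noteq> 1"
  proof
    assume "(0::'a mps) = 1"
    then have "mps_coeff (0::'a mps) 0 = mps_coeff 1 0" by (rule arg_cong)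
    then show False by (simp add: zero_mps_def one_mps_def)
  qed
  show "(a + b) * c = a * c + b * c"
    by (simp add: plus_mps_def times_mps_def sum.distrib case_prod_unfold algebra_simps)
  show "a * b = b * a"
    unfolding times_mps_def
    by (intro arg_cong[where f = Abs_mps] ext sum.reindex_bij_witness[where i = prod.swap and j = prod.swap])
       (auto simp: algebra_simps)
  show "1 * a = a"
  proof (rule mps_eqI)
    fix k
    have "mps_coeff (1 * a) k =
        (\<Sum>p\<in>splits k. if p = (0, k) then mps_coeff a k else 0)"
      unfolding times_mps_def one_mps_def mps_coeff_Abs by (rule sum.cong) (auto split: if_splits)
    then show "mps_coeff (1 * a) k = mps_coeff a k"
      by simp
  qed
  show "a * b * c = a * (b * c)"
  proof (rule mps_eqI)
    fix k
    have "mps_coeff (a * b * c) k =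
        (\<Sum>p\<in>splits k. \<Sum>q\<in>splits (fst p).
          mps_coeff a (fst q) * mps_coeff b (snd q) * mps_coeff c (snd p))"
      by (simp add: times_mps_def sum_distrib_right case_prod_unfold)
    also have "\<dots> = (\<Sum>((l, m), (i, j)) \<in> (SIGMA p:splits k. splits (fst p)).
          mps_coeff a i * mps_coeff b j * mps_coeff c m)"
      by (subst sum.Sigma) (auto intro!: sum.cong)
    also have "\<dots> = (\<Sum>((i, r), (j, m)) \<in> (SIGMA p:splits k. splits (snd p)).
          mps_coeff a i * (mps_coeff b j * mps_coeff c m))"
      by (rule sum.reindex_bij_witness[where
            i = "\<lambda>((i, r), (j, m)). ((i + j, m), (i, j))" and
            j = "\<lambda>((l, m), (i, j)). ((i, j + m), (j, m))"])
         (auto simp: add.assoc mult.assoc)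
    also have "\<dots> = (\<Sum>p\<in>splits k. \<Sum>q\<in>splits (snd p).
          mps_coeff a (fst p) * (mps_coeff b (fst q) * mps_coeff c (snd q)))"
      by (subst sum.Sigma) (auto intro!: sum.cong)
    also have "\<dots> = mps_coeff (a * (b * c)) k"
      by (simp add: times_mps_def sum_distrib_left case_prod_unfold)
    finally show "mps_coeff (a * b * c) k = mps_coeff (a * (b * c)) k" .
  qed
qed

end

text \<open>
  The ring of series in the variables from the set \<open>X\<close> only. Keeping \<open>X\<close> as a set, rather than
  taking the whole type of variables, also covers the empty set of variables.
\<close>

definition mps_over :: "'x set \<Rightarrow> 'x mps set" where
  "mps_over X = {H. \<forall>k. mps_coeff H k \<noteq> 0 \<longrightarrow> Poly_Mapping.keys k \<subseteq> X}"

definition mps_const :: "complex \<Rightarrow> 'x mps" where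
  "mps_const c = Abs_mps (\<lambda>k. if k = 0 then c else 0)"

definition mps_var :: "'x \<Rightarrow> 'x mps" where
  "mps_var x = Abs_mps (\<lambda>k. if k = Poly_Mapping.single x 1 then 1 else 0)"

definition mps_pderiv :: "'x \<Rightarrow> 'x mps \<Rightarrow> 'x mps" where
  "mps_pderiv x H =
    Abs_mps (\<lambda>k. of_nat (Poly_Mapping.lookup k x + 1) * mps_coeff H (k + Poly_Mapping.single x 1))"

definition mps_summable :: "('s \<Rightarrow> 'x mps) \<Rightarrow> 's set \<Rightarrow> bool" where
  "mps_summable G S \<longleftrightarrow> (\<forall>k. finite {s \<in> S. mps_coeff (G s) k \<noteq> 0})"

text \<open>The coefficientwise sum of a family; meaningful for summable families only.\<close>

definition mps_infsum :: "('s \<Rightarrow> 'x mps) \<Rightarrow> 's set \<Rightarrow> 'x mps" where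
  "mps_infsum G S = Abs_mps (\<lambda>k. \<Sum>s\<in>{s \<in> S. mps_coeff (G s) k \<noteq> 0}. mps_coeff (G s) k)"


section \<open>The derivation, its flow, and substitution\<close>

definition mps_derivation :: "'x set \<Rightarrow> ('x \<Rightarrow> 'x mps) \<Rightarrow> 'x mps \<Rightarrow> 'x mps" where
  "mps_derivation S \<phi> H = mps_infsum (\<lambda>x. \<phi> x * mps_pderiv x H) S"

text \<open>\<open>exp_op D H\<close> is \<open>e\<^sup>t\<^sup>D H = (\<Sum>n. D\<^sup>n H t\<^sup>n / n!)\<close>, a series in \<open>t\<close>.\<close>

definition exp_op :: "('x mps \<Rightarrow> 'x mps) \<Rightarrow> 'x mps \<Rightarrow> 'x mps fps" where
  "exp_op D H = Abs_fps (\<lambda>n. mps_const (1 / fact n) * (D ^^ n) H)"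

text \<open>
  The substitution \<open>H(F\<^sub>x(t))\<close>, for \<open>x\<close> ranging over \<open>X\<close>. The sum over exponents is infinite and is
  taken coefficientwise in the monomials of both \<open>X\<close> and \<open>t\<close>. The constant terms \<open>F\<^sub>x(0)\<close> need not
  vanish (for the flow they equal \<open>x\<close>), so this is not a composition of series in \<open>t\<close>.
\<close>

definition mps_subst :: "'x set \<Rightarrow> 'x mps \<Rightarrow> ('x \<Rightarrow> 'x mps fps) \<Rightarrow> 'x mps fps" where
  "mps_subst X H F = Abs_fps (\<lambda>n. mps_infsum
     (\<lambda>k. (fps_const (mps_const (mps_coeff H k)) * (\<Prod>x\<in>Poly_Mapping.keys k. F x ^ Poly_Mapping.lookup k x)) $ n)
     {k. Poly_Mapping.keys k \<subseteq> X})"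


section \<open>Enriched rooted trees\<close>

definition egf_coeff :: "'a::comm_ring_1 fps \<Rightarrow> nat \<Rightarrow> 'a" where
  "egf_coeff A n = of_nat (fact n) * A $ n"

definition enriched_trees :: "'a::comm_ring_1 fps \<Rightarrow> 'a fps" where
  "enriched_trees G = (THE A. A = fps_X * (G oo A))"

lemma fps_power_nth_cong:
  fixes A B :: "'a::comm_ring_1 fps"
  assumes "\<And>i. i \<le> n \<Longrightarrow> A $ i = B $ i" "k \<le> n"
  shows "(A ^ m) $ k = (B ^ m) $ k"
  using assms(2)
  by (induction m arbitrary: k) (auto simp: fps_mult_nth assms(1) intro!: sum.cong)

lemma fps_compose_nth_cong:
  fixes A B :: "'a::comm_ring_1 fps"
  assumes "\<And>i. i \<le> n \<Longrightarrow> A $ i = B $ i"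
  shows "(G oo A) $ n = (G oo B) $ n"
  unfolding fps_compose_nth using fps_power_nth_cong[OF assms] by simp

lemma enriched_trees_ex1:
  fixes G :: "'a::comm_ring_1 fps"
  shows "\<exists>!A. A = fps_X * (G oo A)"
proof (rule ex_ex1I)
  define P where "P m = ((\<lambda>A. fps_X * (G oo A)) ^^ m) 0" for m
  have P_Suc: "P (Suc m) = fps_X * (G oo P m)" for m
    by (simp add: P_def)
  have step: "\<forall>i\<le>m. P (Suc m) $ i = P m $ i" for m
  proof (induction m)
    case 0
    show ?case by (simp add: P_Suc) (simp add: P_def)
  next
    case IH: (Suc m)
    show ?case
    proof (intro allI impI)
      fix i assume "i \<le> Suc m"
      then show "P (Suc (Suc m)) $ i = P (Suc m) $ i"
      proof (cases i)
        case 0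
        then show ?thesis by (simp add: P_Suc)
      next
        case (Suc l)
        then have "(G oo P (Suc m)) $ l = (G oo P m) $ l"
          using IH \<open>i \<le> Suc m\<close> by (intro fps_compose_nth_cong) simp
        then show ?thesis
          using Suc by (subst (1 2) P_Suc) simp
      qed
    qed
  qed
  have stable: "P m $ i = P i $ i" if "i \<le> m" for i m
    using that by (induction rule: dec_induct) (use step in auto)
  let ?A = "Abs_fps (\<lambda>i. P i $ i)"
  have "?A $ n = (fps_X * (G oo ?A)) $ n" for n
  proof (cases n)
    case 0
    then show ?thesis by (simp add: P_def)
  next
    case (Suc m)
    have "(G oo P m) $ m = (G oo ?A) $ m"
      by (rule fps_compose_nth_cong) (simp only: fps_nth_Abs_fps stable[of _ m])
    then show ?thesis using Suc by (simp add: P_Suc)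
  qed
  then show "\<exists>A. A = fps_X * (G oo A)"
    by (intro exI[of _ ?A]) (simp add: fps_eq_iff)
next
  fix A B :: "'a fps"
  assume A: "A = fps_X * (G oo A)" and B: "B = fps_X * (G oo B)"
  have "A $ n = B $ n" for n
  proof (induction n rule: less_induct)
    case (less n)
    show ?case
    proof (cases n)
      case 0
      then show ?thesis by (subst A, subst B) simp
    next
      case (Suc m)
      have "(G oo A) $ m = (G oo B) $ m"
        by (rule fps_compose_nth_cong) (use less Suc in auto)
      then show ?thesis using Suc by (subst A, subst B) simp
    qed
  qed
  then show "A = B" by (simp add: fps_eq_iff)
qed

lemma enriched_trees_eq: "enriched_trees G = fps_X * (G oo enriched_trees G)"
  unfolding enriched_trees_def by (rule theI'[OF enriched_trees_ex1])

end

theory Submission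
  imports Defs
begin

text \<open>
  The operator \<open>e\<^sup>t\<^sup>D\<close> of a derivation \<open>D\<close> is multiplicative, so Lagrange inversion gives
  \<open>n! [t\<^sup>n] A\<^sub>G = (n - 1)! [t\<^sup>n\<^sup>-\<^sup>1] G\<^sup>n = D\<^sup>n\<^sup>-\<^sup>1 H\<^sup>n\<close> for \<open>G = e\<^sup>t\<^sup>D H\<close>.
  Since every coefficient of \<open>D\<^sup>n H\<close> depends linearly on finitely many coefficients of \<open>H\<close>,
  multiplicativity extends from monomials to series and yields \<open>e\<^sup>t\<^sup>D H = H(e\<^sup>t\<^sup>D x)\<close>.
\<close>

section \<open>Lagrange inversion over a torsion-free ring\<close>

text \<open>As \<open>A\<close> has no constant term, \<open>A ^ i\<close> starts in degree at least
  \<open>i\<close>. A common range up to \<open>n\<close> lets products of compositions be expanded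
  over a square.\<close>

lemma fps_compose_nth_upto:
  fixes A G :: "'a::comm_ring_1 fps"
  assumes "A $ 0 = 0" "j \<le> n"
  shows "(G oo A) $ j = (\<Sum>i=0..n. G $ i * (A ^ i) $ j)"
  unfolding fps_compose_nth
  by (rule sum.mono_neutral_left) (use assms startsby_zero_power_prefix[of A] in auto)

text \<open>The library versions of the next two facts require an integral domain.\<close>

lemma fps_compose_mult_comm_ring:
  fixes A G H :: "'a::comm_ring_1 fps"
  assumes A0: "A $ 0 = 0"
  shows "(G * H) oo A = (G oo A) * (H oo A)"
proof (rule fps_ext)
  fix n :: nat
  have "((G oo A) * (H oo A)) $ n =
      ((\<Sum>i=0..n. fps_const (G $ i) * A ^ i) * (\<Sum>j=0..n. fps_const (H $ j) * A ^ j)) $ n"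
    unfolding fps_mult_nth
    by (rule sum.cong) (simp_all add: fps_sum_nth fps_compose_nth_upto[OF A0, of _ n])
  also have "\<dots> = (\<Sum>(i, j)\<in>{0..n} \<times> {0..n}. (fps_const (G $ i * H $ j) * A ^ (i + j)) $ n)"
    unfolding sum_product fps_sum_nth sum.cartesian_product
    by (rule sum.cong) (auto simp: power_add mult_ac simp del: fps_const_mult fps_mult_left_const_nth
        simp flip: fps_const_mult)
  also have "\<dots> = (\<Sum>(i, j)\<in>{(i, j). i + j \<le> n}. G $ i * H $ j * (A ^ (i + j)) $ n)"
  proof (rule sum.mono_neutral_cong_right)
    have zero: "(A ^ k) $ n = 0" if "n < k" for k
      using startsby_zero_power_prefix[OF A0, of k] that by simp
    show "\<forall>p \<in> {0..n} \<times> {0..n} - {(i, j). i + j \<le> n}.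
        (case p of (i, j) \<Rightarrow> (fps_const (G $ i * H $ j) * A ^ (i + j)) $ n) = 0"
      by (intro ballI) (simp add: zero split_beta)
  qed auto
  also have "\<dots> = ((G * H) oo A) $ n"
    using sum_pair_less_iff[of "\<lambda>i. G $ i" "\<lambda>j. H $ j" "\<lambda>s. (A ^ s) $ n" n]
    by (simp add: fps_compose_nth fps_mult_nth sum_distrib_right)
  finally show "((G * H) oo A) $ n = ((G oo A) * (H oo A)) $ n" ..
qed

lemma fps_compose_power_comm_ring:
  fixes A G :: "'a::comm_ring_1 fps"
  assumes "A $ 0 = 0"
  shows "(G ^ k) oo A = (G oo A) ^ k"
  by (induction k) (simp_all add: fps_compose_mult_comm_ring[OF assms])

lemma fps_X_mult_deriv_nth: "(fps_X * fps_deriv B) $ j = of_nat j * B $ j"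
  for B :: "'a::comm_ring_1 fps"
  by (cases j) simp_all

text \<open>
  Comparing coefficients in \<open>A\<^sup>k = t\<^sup>k G\<^sup>k(A)\<close> reduces the claim for \<open>n\<close> to the one for \<open>n - k\<close>;
  in contrast to the usual residue argument, \<open>G\<close> need not be invertible.
\<close>

lemma lagrange_inversion:
  fixes A G :: "'a::comm_ring_1 fps"
  assumes torsion_free: "\<And>m (a::'a) b. m > 0 \<Longrightarrow> of_nat m * a = of_nat m * b \<Longrightarrow> a = b"
    and A: "A = fps_X * (G oo A)"
  shows "k \<le> n \<Longrightarrow> of_nat n * (A ^ k) $ n = of_nat k * (G ^ n) $ (n - k)"
proof (induction n arbitrary: k rule: less_induct)
  case (less n)
  have A0: "A $ 0 = 0"
    by (subst A) simp
  show ?case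
  proof (cases "k = 0")
    case True
    then show ?thesis by simp
  next
    case False
    define m where "m = n - k"
    have n: "n = k + m" using less.prems by (simp add: m_def)
    have "A ^ k = fps_X ^ k * (G ^ k oo A)"
      by (subst A) (simp add: power_mult_distrib fps_compose_power_comm_ring[OF A0])
    then have coeff: "(A ^ k) $ n = (\<Sum>j=0..m. (G ^ k) $ j * (A ^ j) $ m)"
      by (simp add: n fps_X_power_mult_nth fps_compose_nth)
    show ?thesis
    proof (cases "m = 0")
      case True
      then show ?thesis using coeff by (simp add: n)
    next
      case m: False
      \<comment> \<open>Here \<open>m < n\<close> because \<open>k > 0\<close>. All exponents
        \<open>j \<le> m\<close> are needed, so the induction keeps \<open>k\<close>
        arbitrary.\<close>
      have IH: "of_nat m * (A ^ j) $ m = of_nat j * (G ^ m) $ (m - j)" if "j \<le> m" for j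
        using less.IH[of m j] that False by (simp add: n)
      \<comment> \<open>The factor \<open>j\<close> from the induction hypothesis is the operator
        \<open>t d/dt\<close> acting on \<open>G ^ k\<close>, which makes the sum a Cauchy
        product.\<close>
      have "of_nat m * (A ^ k) $ n = (\<Sum>j=0..m. (fps_X * fps_deriv (G ^ k)) $ j * (G ^ m) $ (m - j))"
        unfolding coeff sum_distrib_left fps_X_mult_deriv_nth
        proof (rule sum.cong)
          fix j assume "j \<in> {0..m}"
          then have "of_nat m * ((G ^ k) $ j * (A ^ j) $ m) = (G ^ k) $ j * (of_nat j * (G ^ m) $ (m - j))"
            by (subst mult.left_commute) (simp add: IH)
          then show "of_nat m * ((G ^ k) $ j * (A ^ j) $ m) = of_nat j * (G ^ k) $ j * (G ^ m) $ (m - j)"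
            by (simp only: mult_ac)
        qed simp
      also have "\<dots> = (fps_X * fps_deriv (G ^ k) * G ^ m) $ m"
        by (simp only: fps_mult_nth)
      finally have "of_nat m * (of_nat n * (A ^ k) $ n)
          = (of_nat n * (fps_X * fps_deriv (G ^ k) * G ^ m)) $ m"
        by (simp only: fps_mult_of_nat_nth mult.left_commute[of "of_nat m"])
      \<comment> \<open>Both sides equal \<open>n k t G^(n-1) G'\<close>; as \<open>k > 0\<close>,
        no negative power of \<open>G\<close> arises.\<close>
      also have "of_nat n * (fps_X * fps_deriv (G ^ k) * G ^ m)
          = of_nat k * (fps_X * fps_deriv (G ^ n))"
      proof -
        have "G ^ (k - 1) * G ^ m = G ^ (n - 1)"
          using False by (simp add: n flip: power_add)
        then show ?thesis
          unfolding fps_deriv_power' by (simp add: algebra_simps)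
      qed
      also have "\<dots> $ m = of_nat m * (of_nat k * (G ^ n) $ m)"
        unfolding fps_mult_of_nat_nth fps_X_mult_deriv_nth by (rule mult.left_commute)
      finally show ?thesis
        using torsion_free[of m] m by (simp add: n)
    qed
  qed
qed

section \<open>Coefficients of multivariate series\<close>

lemma mps_coeff_zero [simp]: "mps_coeff 0 k = 0"
  by (simp add: zero_mps_def)

lemma mps_coeff_add [simp]: "mps_coeff (G + H) k = mps_coeff G k + mps_coeff H k"
  by (simp add: plus_mps_def)

lemma mps_coeff_mult: "mps_coeff (G * H) k = (\<Sum>(i, j)\<in>splits k. mps_coeff G i * mps_coeff H j)"
  by (simp add: times_mps_def)

lemma mps_coeff_sum [simp]: "mps_coeff (sum f T) k = (\<Sum>x\<in>T. mps_coeff (f x) k)"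
  by (induction T rule: infinite_finite_induct) simp_all

lemma mps_coeff_const_mult [simp]: "mps_coeff (mps_const c * H) k = c * mps_coeff H k"
proof -
  have "mps_coeff (mps_const c * H) k =
      (\<Sum>p\<in>splits k. if p = (0, k) then c * mps_coeff H k else 0)"
    unfolding mps_coeff_mult mps_const_def mps_coeff_Abs by (rule sum.cong) (auto split: if_splits)
  then show ?thesis
    by simp
qed

lemma mps_const_mult: "mps_const (a * b) = mps_const a * mps_const b"
  by (rule mps_eqI) (simp, simp add: mps_const_def)

lemma mps_const_1 [simp]: "mps_const 1 = 1"
  by (simp add: mps_const_def one_mps_def)

lemma mps_const_add: "mps_const (a + b) = mps_const a + mps_const b"
  by (rule mps_eqI) (simp add: mps_const_def)

lemma of_nat_mps: "of_nat n = mps_const (of_nat n)"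
proof (induction n)
  case 0
  show ?case by (simp add: mps_const_def zero_mps_def)
next
  case (Suc n)
  then show ?case
    by (simp add: mps_const_add)
qed

text \<open>Multiplication by \<open>of_nat m\<close> scales each coefficient by a nonzero complex
  number. This serves \<open>lagrange_inversion\<close> and the recursion for
  \<open>exp_op\<close>.\<close>

lemma mps_torsion_free:
  fixes G H :: "'x mps"
  assumes "m > 0" "of_nat m * G = of_nat m * H"
  shows "G = H"
proof (rule mps_eqI)
  fix k
  show "mps_coeff G k = mps_coeff H k"
    using arg_cong[OF assms(2), of "\<lambda>F. mps_coeff F k"] assms(1) by (simp add: of_nat_mps)
qed

text \<open>The bare monomial, without the factor \<open>1 / k!\<close>, matching the ordinary
  coefficients of \<open>mps_coeff\<close>.\<close>

definition mps_monom :: "('x \<Rightarrow>\<^sub>0 nat) \<Rightarrow> 'x mps" where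
  "mps_monom k = Abs_mps (\<lambda>j. if j = k then 1 else 0)"

lemma mps_monom_0: "mps_monom 0 = 1"
  by (simp add: mps_monom_def one_mps_def)

lemma mps_monom_add: "mps_monom (i + j) = mps_monom i * mps_monom j"
proof (rule mps_eqI)
  fix k
  have "mps_coeff (mps_monom i * mps_monom j) k =
      (\<Sum>p\<in>splits k. if p = (i, j) then 1 else 0)"
    unfolding mps_coeff_mult mps_monom_def mps_coeff_Abs
    by (rule sum.cong) (auto split: if_splits)
  then show "mps_coeff (mps_monom (i + j)) k = mps_coeff (mps_monom i * mps_monom j) k"
    by (auto simp: mps_monom_def)
qed

lemma mps_monom_single: "mps_monom (Poly_Mapping.single x n) = mps_var x ^ n"
proof (induction n)
  case 0
  show ?case by (simp add: mps_monom_0)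
next
  case (Suc n)
  have "Poly_Mapping.single x (Suc n) = Poly_Mapping.single x 1 + Poly_Mapping.single x n"
    by (simp flip: single_add)
  then have "mps_monom (Poly_Mapping.single x (Suc n))
      = mps_monom (Poly_Mapping.single x 1) * mps_monom (Poly_Mapping.single x n)"
    by (simp only: mps_monom_add)
  then show ?case
    using Suc by (simp add: mps_var_def mps_monom_def)
qed

lemma mps_monom_sum: "mps_monom (\<Sum>x\<in>T. f x) = (\<Prod>x\<in>T. mps_monom (f x))"
  by (induction T rule: infinite_finite_induct) (simp_all add: mps_monom_0 mps_monom_add)

lemma poly_mapping_eq_sum_single:
  fixes k :: "'x \<Rightarrow>\<^sub>0 nat"
  shows "k = (\<Sum>x\<in>Poly_Mapping.keys k. Poly_Mapping.single x (Poly_Mapping.lookup k x))"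
  by (rule poly_mapping_eqI) (auto simp: lookup_sum lookup_single when_def in_keys_iff)

lemma mps_monom_eq_prod:
  "mps_monom k = (\<Prod>x\<in>Poly_Mapping.keys k. mps_var x ^ Poly_Mapping.lookup k x)"
  by (subst poly_mapping_eq_sum_single) (simp only: mps_monom_sum mps_monom_single)

lemma mps_coeff_infsum:
  assumes "finite T" "T \<subseteq> S" "\<And>s. s \<in> S - T \<Longrightarrow> mps_coeff (G s) k = 0"
  shows "mps_coeff (mps_infsum G S) k = (\<Sum>s\<in>T. mps_coeff (G s) k)"
  unfolding mps_infsum_def mps_coeff_Abs
  by (rule sum.mono_neutral_left) (use assms in auto)

section \<open>The derivation\<close>

lemma mps_coeff_pderiv:
  "mps_coeff (mps_pderiv x H) k
    = of_nat (Poly_Mapping.lookup k x + 1) * mps_coeff H (k + Poly_Mapping.single x 1)"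
  by (simp add: mps_pderiv_def)

lemma mps_pderiv_add: "mps_pderiv x (G + H) = mps_pderiv x G + mps_pderiv x H"
  by (rule mps_eqI) (simp add: mps_coeff_pderiv algebra_simps)

lemma mps_pderiv_scale: "mps_pderiv x (mps_const c * H) = mps_const c * mps_pderiv x H"
  by (rule mps_eqI) (simp add: mps_coeff_pderiv mult.left_commute)

text \<open>Shifting \<open>i\<close> by one at \<open>x\<close> turns the weight
  \<open>i_x + 1\<close> into \<open>i_x\<close>. Splits of the shifted exponent serve as one index
  set for both halves of the Leibniz rule.\<close>

lemma mps_coeff_pderiv_mult_left:
  "mps_coeff (mps_pderiv x G * H) k
    = (\<Sum>(i, j)\<in>splits (k + Poly_Mapping.single x 1).
        of_nat (Poly_Mapping.lookup i x) * mps_coeff G i * mps_coeff H j)"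
proof -
  let ?e = "Poly_Mapping.single x (1::nat)"
  have "mps_coeff (mps_pderiv x G * H) k
    = (\<Sum>(i, j)\<in>{(i, j) \<in> splits (k + ?e). Poly_Mapping.lookup i x \<noteq> 0}.
        of_nat (Poly_Mapping.lookup i x) * mps_coeff G i * mps_coeff H j)"
    unfolding mps_coeff_mult mps_coeff_pderiv
  proof (rule sum.reindex_bij_witness[where
        i = "\<lambda>(i, j). (i - ?e, j)" and j = "\<lambda>(i, j). (i + ?e, j)"], goal_cases)
    case (1 a)
    then show ?case by (auto simp: algebra_simps)
  next
    case (2 a)
    then show ?case by (auto simp: lookup_add algebra_simps)
  next
    case (3 a)
    obtain i j where a: "a = (i, j)" by (cases a)
    \<comment> \<open>Subtraction of exponents is truncated; adding \<open>?e\<close> undoes it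
      because \<open>i\<close> is positive at \<open>x\<close>.\<close>
    have "i - ?e + ?e = i"
      by (rule poly_mapping_eqI) (use 3 a in \<open>auto simp: lookup_add lookup_minus lookup_single when_def\<close>)
    then show ?case using a by simp
  next
    case (4 a)
    obtain i j where a: "a = (i, j)" by (cases a)
    have "i - ?e + ?e = i"
      by (rule poly_mapping_eqI) (use 4 a in \<open>auto simp: lookup_add lookup_minus lookup_single when_def\<close>)
    then have "i - ?e + j + ?e = k + ?e"
      using 4 a by (simp add: algebra_simps)
    then show ?case using a by simp
  next
    case (5 a)
    then show ?case by (auto simp: lookup_add)
  qed
  also have "\<dots> = (\<Sum>(i, j)\<in>splits (k + ?e).
        of_nat (Poly_Mapping.lookup i x) * mps_coeff G i * mps_coeff H j)"
    by (rule sum.mono_neutral_left) auto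
  finally show ?thesis .
qed

text \<open>For each split of the shifted exponent \<open>i_x + j_x = k_x + 1\<close>, so the
  weights of the two summands add up to the factor from differentiating the product.\<close>

lemma mps_pderiv_mult: "mps_pderiv x (G * H) = mps_pderiv x G * H + G * mps_pderiv x H"
proof (rule mps_eqI)
  fix k
  let ?s = "splits (k + Poly_Mapping.single x (1::nat))"
  have "mps_coeff (G * mps_pderiv x H) k =
      (\<Sum>(i, j)\<in>?s. of_nat (Poly_Mapping.lookup i x) * mps_coeff H i * mps_coeff G j)"
    using mps_coeff_pderiv_mult_left[of x H G k] by (simp add: mult.commute)
  also have "\<dots> = (\<Sum>(i, j)\<in>?s. of_nat (Poly_Mapping.lookup j x) * mps_coeff H j * mps_coeff G i)"
    by (rule sum.reindex_bij_witness[where i = prod.swap and j = prod.swap])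
       (auto simp: add.commute)
  finally have "mps_coeff (mps_pderiv x G * H + G * mps_pderiv x H) k =
      (\<Sum>(i, j)\<in>?s. of_nat (Poly_Mapping.lookup i x) * mps_coeff G i * mps_coeff H j)
      + (\<Sum>(i, j)\<in>?s. of_nat (Poly_Mapping.lookup j x) * mps_coeff H j * mps_coeff G i)"
    by (simp only: mps_coeff_add mps_coeff_pderiv_mult_left)
  also have "\<dots> = (\<Sum>(i, j)\<in>?s. of_nat (Poly_Mapping.lookup (i + j) x) * (mps_coeff G i * mps_coeff H j))"
    by (simp add: lookup_add algebra_simps case_prod_unfold flip: sum.distrib)
  also have "\<dots> = (\<Sum>(i, j)\<in>?s.
      of_nat (Poly_Mapping.lookup k x + 1) * (mps_coeff G i * mps_coeff H j))"
  proof (rule sum.cong)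
    fix p assume "p \<in> ?s"
    then have "Poly_Mapping.lookup (fst p + snd p) x = Poly_Mapping.lookup k x + 1"
      by (simp add: case_prod_unfold) (simp add: lookup_add)
    then show "(case p of (i, j) \<Rightarrow>
          of_nat (Poly_Mapping.lookup (i + j) x) * (mps_coeff G i * mps_coeff H j)) =
        (case p of (i, j) \<Rightarrow>
          of_nat (Poly_Mapping.lookup k x + 1) * (mps_coeff G i * mps_coeff H j))"
      by (simp only: case_prod_unfold)
  qed simp
  also have "\<dots> = mps_coeff (mps_pderiv x (G * H)) k"
    by (simp add: mps_coeff_pderiv mps_coeff_mult sum_distrib_left case_prod_unfold)
  finally show "mps_coeff (mps_pderiv x (G * H)) k
      = mps_coeff (mps_pderiv x G * H + G * mps_pderiv x H) k" ..
qed

text \<open>A product at \<open>i\<close> sees \<open>\<phi> x\<close> only at the finitely many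
  exponents below \<open>i\<close>, where summability leaves finitely many \<open>x\<close>. The set
  \<open>T\<close> is uniform in \<open>H\<close> and in all exponents below
  \<open>k\<close>.\<close>

lemma mps_derivation_truncate:
  assumes "mps_summable \<phi> S"
  obtains T where "finite T"
    "\<And>H i j. i + j = k \<Longrightarrow>
      mps_coeff (mps_derivation S \<phi> H) i = mps_coeff (\<Sum>x\<in>T. \<phi> x * mps_pderiv x H) i"
proof
  let ?T = "\<Union>p\<in>splits k. \<Union>q\<in>splits (fst p). {x \<in> S. mps_coeff (\<phi> x) (fst q) \<noteq> 0}"
  show "finite ?T"
    using assms by (auto simp: mps_summable_def)
  show "mps_coeff (mps_derivation S \<phi> H) i = mps_coeff (\<Sum>x\<in>?T. \<phi> x * mps_pderiv x H) i"
    if "i + j = k" for H i j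
    unfolding mps_derivation_def mps_coeff_sum
  proof (rule mps_coeff_infsum)
    fix x assume x: "x \<in> S - ?T"
    have "mps_coeff (\<phi> x) a = 0" if "a + b = i" for a b
      using x that \<open>i + j = k\<close> by auto
    then show "mps_coeff (\<phi> x * mps_pderiv x H) i = 0"
      unfolding mps_coeff_mult by (auto intro!: sum.neutral)
  qed (use \<open>finite ?T\<close> in auto)
qed

text \<open>Isolates the algebra from summability. The law \<open>scale\<close> does not follow from
  the other two, since the complex field has nonzero derivations.\<close>

locale mps_derivation_op =
  fixes D :: "'x mps \<Rightarrow> 'x mps"
  assumes add: "D (G + H) = D G + D H"
    and mult: "D (G * H) = D G * H + G * D H"
    and scale: "D (mps_const c * H) = mps_const c * D H"

lemma mps_derivation_op:
  assumes "mps_summable \<phi> S"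
  shows "mps_derivation_op (mps_derivation S \<phi>)"
proof (unfold_locales; rule mps_eqI)
  fix G H :: "'a mps" and c k
  let ?D = "mps_derivation S \<phi>"
  obtain T where T: "\<And>H i j. i + j = k \<Longrightarrow>
      mps_coeff (?D H) i = mps_coeff (\<Sum>x\<in>T. \<phi> x * mps_pderiv x H) i"
    using mps_derivation_truncate[OF assms] by metis
  define E where "E H = (\<Sum>x\<in>T. \<phi> x * mps_pderiv x H)" for H
  have DE: "mps_coeff (?D H) k = mps_coeff (E H) k" for H
    unfolding E_def by (rule T[of k 0]) simp
  show "mps_coeff (?D (G + H)) k = mps_coeff (?D G + ?D H) k"
    by (simp add: DE) (simp add: E_def mps_pderiv_add distrib_left sum.distrib)
  show "mps_coeff (?D (mps_const c * H)) k = mps_coeff (mps_const c * ?D H) k"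
    by (simp add: DE) (simp add: E_def mps_pderiv_scale sum_distrib_left mult.left_commute)
  \<comment> \<open>The coefficient at \<open>k\<close> of a product involves \<open>?D G\<close> at
    every exponent below \<open>k\<close>, so agreement with \<open>E\<close> at \<open>k\<close>
    alone would not suffice.\<close>
  have mult_DE: "mps_coeff (?D G * H) k = mps_coeff (E G * H) k" for G H
    unfolding mps_coeff_mult by (rule sum.cong) (auto simp: T E_def)
  have "mps_coeff (?D G * H + G * ?D H) k = mps_coeff (E G * H + G * E H) k"
    using mult_DE[of G H] mult_DE[of H G] by (simp add: mult.commute)
  also have "E G * H + G * E H = E (G * H)"
    by (simp add: E_def mps_pderiv_mult sum_distrib_left sum_distrib_right algebra_simps
        flip: sum.distrib)
  finally show "mps_coeff (?D (G * H)) k = mps_coeff (?D G * H + G * ?D H) k"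
    by (simp only: DE)
qed

section \<open>The exponential of a derivation\<close>

context mps_derivation_op
begin

lemma zero: "D 0 = 0"
  using add[of 0 0] by simp

lemma sum: "D (\<Sum>x\<in>T. f x) = (\<Sum>x\<in>T. D (f x))"
  by (induction T rule: infinite_finite_induct) (simp_all add: zero add)

lemma one: "D 1 = 0"
  using mult[of 1 1] by simp

lemma exp_op_nth_0 [simp]: "exp_op D H $ 0 = H"
  by (simp add: exp_op_def)

text \<open>Coefficient form of \<open>dU/dt = D U\<close> for \<open>U = e^(tD) H\<close>.\<close>

lemma exp_op_nth_Suc: "of_nat (Suc n) * exp_op D H $ Suc n = D (exp_op D H $ n)"
  by (simp add: exp_op_def scale of_nat_mps flip: mps_const_mult mult.assoc del: of_nat_Suc)

lemma exp_op_one: "exp_op D 1 = 1"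
proof (rule fps_ext)
  fix n
  show "exp_op D 1 $ n = 1 $ n"
  proof (induction n)
    case (Suc n)
    have "of_nat (Suc n) * exp_op D 1 $ Suc n = of_nat (Suc n) * 0"
      unfolding exp_op_nth_Suc Suc by (simp add: zero one)
    then have "exp_op D 1 $ Suc n = 0"
      by (rule mps_torsion_free[rotated]) simp
    then show ?case
      by simp
  qed simp
qed

text \<open>Both sides have constant term \<open>G * H\<close> and satisfy
  \<open>dU/dt = D U\<close>, a recursion that fixes all coefficients.\<close>

lemma exp_op_mult: "exp_op D (G * H) = exp_op D G * exp_op D H"
proof (rule fps_ext)
  fix n
  \<comment> \<open>\<open>D'\<close> extends \<open>D\<close> to series in \<open>t\<close>
    coefficientwise; it is again a derivation, and on exponentials it coincides with
    \<open>d/dt\<close>.\<close>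
  define D' where "D' A = Abs_fps (\<lambda>n. D (A $ n))" for A
  have D'_mult: "D' (A * B) = D' A * B + A * D' B" for A B
    by (rule fps_ext) (simp add: D'_def fps_mult_nth sum mult sum.distrib)
  have deriv: "fps_deriv (exp_op D H) = D' (exp_op D H)" for H
    by (rule fps_ext) (simp only: fps_deriv_nth exp_op_nth_Suc D'_def fps_nth_Abs_fps flip: Suc_eq_plus1)
  show "exp_op D (G * H) $ n = (exp_op D G * exp_op D H) $ n"
  proof (induction n)
    case (Suc n)
    have "of_nat (Suc n) * exp_op D (G * H) $ Suc n = D ((exp_op D G * exp_op D H) $ n)"
      by (simp only: exp_op_nth_Suc Suc)
    also have "\<dots> = D' (exp_op D G * exp_op D H) $ n"
      by (simp only: D'_def fps_nth_Abs_fps)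
    also have "\<dots> = fps_deriv (exp_op D G * exp_op D H) $ n"
      by (simp only: D'_mult fps_deriv_mult deriv add.commute)
    also have "\<dots> = of_nat (Suc n) * (exp_op D G * exp_op D H) $ Suc n"
      by (simp only: fps_deriv_nth flip: Suc_eq_plus1)
    finally show ?case
      by (rule mps_torsion_free[rotated]) simp
  qed simp
qed

lemma exp_op_power: "exp_op D (H ^ n) = exp_op D H ^ n"
  by (induction n) (simp_all add: exp_op_one exp_op_mult)

lemma exp_op_prod: "exp_op D (\<Prod>x\<in>T. f x) = (\<Prod>x\<in>T. exp_op D (f x))"
  by (induction T rule: infinite_finite_induct) (simp_all add: exp_op_one exp_op_mult)

text \<open>Lagrange inversion with \<open>k = 1\<close> absorbs the factor \<open>n\<close> of
  \<open>n!\<close>; the remaining \<open>(n - 1)!\<close> cancels the denominator in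
  \<open>exp_op D (H ^ n)\<close>.\<close>

lemma egf_coeff_enriched_trees_exp_op:
  assumes "n \<ge> 1"
  shows "egf_coeff (enriched_trees (exp_op D H)) n = (D ^^ (n - 1)) (H ^ n)"
proof -
  obtain m where n: "n = Suc m"
    using assms by (cases n) auto
  have "of_nat n * (enriched_trees (exp_op D H) ^ 1) $ n = of_nat 1 * (exp_op D H ^ n) $ (n - 1)"
    by (rule lagrange_inversion[OF _ enriched_trees_eq]) (erule mps_torsion_free, assumption, rule assms)
  then have "of_nat n * enriched_trees (exp_op D H) $ n = exp_op D (H ^ n) $ m"
    by (simp add: exp_op_power n del: power_Suc)
  then have "egf_coeff (enriched_trees (exp_op D H)) n = of_nat (fact m) * exp_op D (H ^ n) $ m"
    by (simp only: egf_coeff_def n fact_Suc of_nat_mult of_nat_id mult_ac)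
  also have "\<dots> = (D ^^ m) (H ^ n)"
    by (simp add: exp_op_def of_nat_mps flip: mps_const_mult mult.assoc)
  finally show ?thesis
    by (simp add: n)
qed

end

section \<open>The flow as a substitution\<close>

text \<open>These are the continuous linear functionals for the product topology on coefficients.
  \<open>K\<close> is chosen before \<open>H\<close>, so that identities pass from monomials to all
  series.\<close>

definition finitary :: "('x mps \<Rightarrow> complex) \<Rightarrow> bool" where
  "finitary f \<longleftrightarrow> (\<exists>K c. finite K \<and> (\<forall>H. f H = (\<Sum>k\<in>K. c k * mps_coeff H k)))"

lemma finitary_coeff: "finitary (\<lambda>H. mps_coeff H k)"
  unfolding finitary_def by (intro exI[of _ "{k}"] exI[of _ "\<lambda>_. 1"]) simp

lemma finitary_scale:
  assumes "finitary f"
  shows "finitary (\<lambda>H. a * f H)"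
proof -
  obtain K c where K: "finite K" "\<And>H. f H = (\<Sum>k\<in>K. c k * mps_coeff H k)"
    using assms unfolding finitary_def by metis
  have "a * f H = (\<Sum>k\<in>K. (a * c k) * mps_coeff H k)" for H
    by (simp only: K(2) sum_distrib_left mult.assoc)
  then show ?thesis
    unfolding finitary_def using K(1) by (intro exI[of _ K] exI[of _ "\<lambda>k. a * c k"]) blast
qed

lemma finitary_add:
  assumes "finitary f" "finitary g"
  shows "finitary (\<lambda>H. f H + g H)"
proof -
  obtain K c L d where K: "finite K" "\<And>H. f H = (\<Sum>k\<in>K. c k * mps_coeff H k)"
    and L: "finite L" "\<And>H. g H = (\<Sum>k\<in>L. d k * mps_coeff H k)"
    using assms unfolding finitary_def by metis
  let ?e = "\<lambda>k. (if k \<in> K then c k else 0) + (if k \<in> L then d k else 0)"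
  have "f H + g H = (\<Sum>k\<in>K \<union> L. ?e k * mps_coeff H k)" for H
  proof -
    have "f H = (\<Sum>k\<in>K \<union> L. (if k \<in> K then c k else 0) * mps_coeff H k)"
      unfolding K(2) by (rule sum.mono_neutral_cong_left) (use K L in auto)
    moreover have "g H = (\<Sum>k\<in>K \<union> L. (if k \<in> L then d k else 0) * mps_coeff H k)"
      unfolding L(2) by (rule sum.mono_neutral_cong_left) (use K L in auto)
    ultimately show ?thesis
      by (simp only: distrib_right sum.distrib)
  qed
  then show ?thesis
    unfolding finitary_def using K(1) L(1) by (intro exI[of _ "K \<union> L"] exI[of _ ?e]) simp
qed

lemma finitary_sum: "finite T \<Longrightarrow> (\<And>x. x \<in> T \<Longrightarrow> finitary (f x)) \<Longrightarrow> finitary (\<lambda>H. \<Sum>x\<in>T. f x H)"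
proof (induction T rule: finite_induct)
  case empty
  show ?case using finitary_scale[OF finitary_coeff, of 0] by simp
qed (simp add: finitary_add)

lemma finitary_compose:
  assumes "finitary f" "\<And>k. finitary (\<lambda>H. mps_coeff (L H) k)"
  shows "finitary (\<lambda>H. f (L H))"
proof -
  obtain K c where K: "finite K" "\<And>H. f H = (\<Sum>k\<in>K. c k * mps_coeff H k)"
    using assms(1) unfolding finitary_def by metis
  show ?thesis
    unfolding K(2) by (rule finitary_sum[OF K(1)], rule finitary_scale, rule assms(2))
qed

text \<open>Evaluation at a monomial reads off its weight \<open>c k\<close>, so the values on
  monomials determine \<open>f\<close> even on infinite series.\<close>

lemma finitary_eq_sum_monom:
  assumes "finitary f"
  obtains K where "finite K" "\<And>k. k \<notin> K \<Longrightarrow> f (mps_monom k) = 0"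
    "\<And>H. f H = (\<Sum>k\<in>K. mps_coeff H k * f (mps_monom k))"
proof -
  obtain K c where K: "finite K" and f: "\<And>H. f H = (\<Sum>k\<in>K. c k * mps_coeff H k)"
    using assms unfolding finitary_def by metis
  have monom: "f (mps_monom k) = (if k \<in> K then c k else 0)" for k
  proof -
    have "f (mps_monom k) = (\<Sum>j\<in>K. if j = k then c j else 0)"
      unfolding f by (rule sum.cong) (auto simp: mps_monom_def)
    then show ?thesis using K by simp
  qed
  show ?thesis
  proof (rule that[OF K])
    show "f H = (\<Sum>k\<in>K. mps_coeff H k * f (mps_monom k))" for H
      unfolding monom by (subst f, rule sum.cong) auto
  qed (simp add: monom)
qed

text \<open>As the truncation set \<open>T\<close> is the same for every \<open>H\<close>, only
  finitely many coefficients of \<open>H\<close> enter, with fixed weights.\<close>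

lemma finitary_coeff_derivation:
  assumes "mps_summable \<phi> S"
  shows "finitary (\<lambda>H. mps_coeff (mps_derivation S \<phi> H) k)"
proof -
  obtain T where T: "finite T" "\<And>H i j. i + j = k \<Longrightarrow>
      mps_coeff (mps_derivation S \<phi> H) i = mps_coeff (\<Sum>x\<in>T. \<phi> x * mps_pderiv x H) i"
    using mps_derivation_truncate[OF assms] by metis
  have "mps_coeff (mps_derivation S \<phi> H) k = (\<Sum>x\<in>T. \<Sum>p\<in>splits k. mps_coeff (\<phi> x) (fst p) *
      (of_nat (Poly_Mapping.lookup (snd p) x + 1) * mps_coeff H (snd p + Poly_Mapping.single x 1)))"
    for H
    using T(2)[of k 0] by (simp add: mps_coeff_mult mps_coeff_pderiv case_prod_unfold)
  then show ?thesis
    by (simp only:) (rule finitary_sum[OF T(1)], rule finitary_sum[OF finite_splits],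
        rule finitary_scale, rule finitary_scale, rule finitary_coeff)
qed

lemma finitary_coeff_derivation_funpow:
  assumes "mps_summable \<phi> S"
  shows "finitary (\<lambda>H. mps_coeff ((mps_derivation S \<phi> ^^ n) H) k)"
proof (induction n arbitrary: k)
  case 0
  show ?case by (simp add: finitary_coeff)
next
  case (Suc n)
  show ?case
    using finitary_compose[OF finitary_coeff_derivation[OF assms] Suc] by simp
qed

lemma mps_subst_exp_op:
  assumes summable: "mps_summable \<phi> S" and H: "H \<in> mps_over X"
  shows "mps_subst X H (\<lambda>x. exp_op (mps_derivation S \<phi>) (mps_var x))
    = exp_op (mps_derivation S \<phi>) H"
proof (rule fps_ext, rule mps_eqI)
  fix n m
  let ?E = "exp_op (mps_derivation S \<phi>)" and ?X = "{k. Poly_Mapping.keys k \<subseteq> X}"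
  interpret mps_derivation_op "mps_derivation S \<phi>"
    using summable by (rule mps_derivation_op)
  \<comment> \<open>Seen as a functional of the series, one fixed coefficient of the exponential is
    finitary, so it suffices to know it on monomials.\<close>
  define f where "f H = mps_coeff (?E H $ n) m" for H
  have "finitary f"
    unfolding f_def exp_op_def fps_nth_Abs_fps mps_coeff_const_mult
    by (rule finitary_scale[OF finitary_coeff_derivation_funpow[OF summable]])
  then obtain K where K: "finite K" "\<And>k. k \<notin> K \<Longrightarrow> f (mps_monom k) = 0"
    "\<And>H. f H = (\<Sum>k\<in>K. mps_coeff H k * f (mps_monom k))"
    by (rule finitary_eq_sum_monom) blast
  have "(\<Prod>x\<in>Poly_Mapping.keys k. ?E (mps_var x) ^ Poly_Mapping.lookup k x) = ?E (mps_monom k)" for k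
    by (simp add: mps_monom_eq_prod exp_op_prod exp_op_power)
  then have "mps_coeff (mps_subst X H (\<lambda>x. ?E (mps_var x)) $ n) m
      = mps_coeff (mps_infsum (\<lambda>k. mps_const (mps_coeff H k) * ?E (mps_monom k) $ n) ?X) m"
    by (simp add: mps_subst_def)
  \<comment> \<open>The substitution converges at this coefficient because \<open>f\<close> vanishes
    on monomials outside \<open>K\<close>.\<close>
  also have "\<dots> = (\<Sum>k\<in>K \<inter> ?X. mps_coeff H k * f (mps_monom k))"
    using K(1,2) by (subst mps_coeff_infsum[of "K \<inter> ?X"]) (auto simp: f_def)
  \<comment> \<open>Exponents in \<open>K\<close> using variables outside \<open>X\<close>
    contribute nothing, since \<open>H\<close> lies in \<open>mps_over X\<close>.\<close>
  also have "\<dots> = (\<Sum>k\<in>K. mps_coeff H k * f (mps_monom k))"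
    by (rule sum.mono_neutral_left) (use K(1) H in \<open>auto simp: mps_over_def\<close>)
  also have "\<dots> = mps_coeff (?E H $ n) m"
    using K(3)[of H] by (simp only: f_def)
  finally show "mps_coeff (mps_subst X H (\<lambda>x. ?E (mps_var x)) $ n) m = mps_coeff (?E H $ n) m" .
qed

theorem corollary6:
  fixes X S :: "'x set" and \<phi> :: "'x \<Rightarrow> 'x mps" and H :: "'x mps"
  assumes "S \<subseteq> X"
    and "\<And>x. x \<in> S \<Longrightarrow> \<phi> x \<in> mps_over X"
    and "mps_summable \<phi> S"
    and "H \<in> mps_over X"
    and "H \<noteq> 0"
  shows "(\<forall>n\<ge>1. egf_coeff
            (enriched_trees (mps_subst X H (\<lambda>x. exp_op (mps_derivation S \<phi>) (mps_var x)))) n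
          = (mps_derivation S \<phi> ^^ (n - 1)) (H ^ n))
       \<and> (\<forall>x\<in>X. \<forall>n\<ge>1. egf_coeff
            (enriched_trees (exp_op (mps_derivation S \<phi>) (mps_var x))) n
          = (mps_derivation S \<phi> ^^ (n - 1)) (mps_var x ^ n))"
proof -
  interpret mps_derivation_op "mps_derivation S \<phi>"
    using assms(3) by (rule mps_derivation_op)
  \<comment> \<open>The second claim is the tree formula for the series \<open>x\<close> itself,
    whose exponential is already the flow.\<close>
  show ?thesis
    using assms(3,4) by (simp add: mps_subst_exp_op egf_coeff_enriched_trees_exp_op)
qed

end
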